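(* Let $(A,\mu,\alpha,\beta)$ be a left BiHom-alternative algebra over a field $\mathbb{K}$ of characteristic $0$ and let $(V,\ell,r,\phi,\psi)$ be a representation of it. Then the composite $\delta^2\circ\delta^1: C^1_{\alpha,\beta}(A;V)\to C^3_{\alpha,\beta}(A;V)$ is zero.
   Context: Write $xy=\mu(x,y)$. A left BiHom-alternative algebra $(A,\mu,\alpha,\beta)$ is a $\mathbb{K}$-vector space $A$ with a bilinear map $\mu:A\times A\to A$ and linear maps $\alpha,\beta:A\to A$ such that $\alpha\beta=\beta\alpha$, $\alpha(xy)=\alpha(x)\alpha(y)$, $\beta(xy)=\beta(x)\beta(y)$, and for all $x,y,z\in A$ $$as_{\alpha,\beta}(\beta(x),\alpha(y),z)+as_{\alpha,\beta}(\beta(y),\alpha(x),z)=0,$$ where $as_{\alpha,\beta}(x,y,z)=(xy)\beta(z)-\alpha(x)(yz)$. A representation (bimodule) $(V,\ell,r,\phi,\psi)$ consists of a vector space $V$, linear maps $\ell,r:A\to gl(V)$ (where $gl(V)$ denotes the linear endomorphisms of $V$) and two commuting linear maps $\phi,\psi\in gl(V)$ such that for all $x,y\in A$, $v\in V$: (i) $\phi\ell(x)=\ell(\alpha(x))\phi$, $\phi r(x)=r(\alpha(x))\phi$, $\psi\ell(x)=\ell(\beta(x))\psi$, $\psi r(x)=r(\beta(x))\psi$; (ii) $\ell(\beta(x)\alpha(x))\psi(v)=\ell(\alpha\beta(x))\ell(\alpha(x))v$; (iii) $r(\beta(x)\alpha(x))\phi(v)=r(\alpha\beta(x))r(\beta(x))v$;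 (iv) $r(\beta(y))\ell(\beta(x))\phi(v)-\ell(\alpha\beta(x))r(y)\phi(v)=r(\alpha(x)y)\phi\psi(v)-r(\beta(y))r(\alpha(x))\psi(v)$; (v) $\ell(\alpha(y))r(\alpha(x))\psi(v)-r(\alpha\beta(x))\ell(y)\psi(v)=\ell(y\beta(x))\phi\psi(v)-\ell(\alpha(y))\ell(\beta(x))\phi(v)$. For $n\ge 1$, $C^n_{\alpha,\beta}(A;V)$ is the space of $n$-linear maps $f:A^n\to V$ with $\phi(f(x_1,\dots,x_n))=f(\alpha(x_1),\dots,\alpha(x_n))$ and $\psi(f(x_1,\dots,x_n))=f(\beta(x_1),\dots,\beta(x_n))$. The operators $\delta^1:C^1_{\alpha,\beta}(A;V)\to C^2_{\alpha,\beta}(A;V)$ and $\delta^2:C^2_{\alpha,\beta}(A;V)\to C^3_{\alpha,\beta}(A;V)$ are $$\delta^1f(x,y)=\ell(x)f(y)+r(y)f(x)-f(xy),$$ $$\delta^2f(x,y,z)=r(\beta(z))f(\beta(x),\alpha(y))-\ell(\alpha\beta(x))f(\alpha(y),z)+r(\beta(z))f(\beta(y),\alpha(x))-\ell(\alpha\beta(y))f(\alpha(x),z)$$ $$\qquad+f(\beta(x)\alpha(y),\beta(z))-f(\alpha\beta(x),\alpha(y)z)+f(\beta(y)\alpha(x),\beta(z))-f(\alpha\beta(y),\alpha(x)z).$$ *)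

theory Defs
  imports Complex_Main
begin

definition bilinear_map ::
  "('k::field \<Rightarrow> 'a::ab_group_add \<Rightarrow> 'a) \<Rightarrow> ('k \<Rightarrow> 'b::ab_group_add \<Rightarrow> 'b) \<Rightarrow>
   ('k \<Rightarrow> 'c::ab_group_add \<Rightarrow> 'c) \<Rightarrow> ('a \<Rightarrow> 'b \<Rightarrow> 'c) \<Rightarrow> bool"
  where "bilinear_map sA sB sC f \<longleftrightarrow>
    (\<forall>y. Vector_Spaces.linear sA sC (\<lambda>x. f x y)) \<and> (\<forall>x. Vector_Spaces.linear sB sC (f x))"

definition bihom_associator ::
  "('a::ab_group_add \<Rightarrow> 'a \<Rightarrow> 'a) \<Rightarrow> ('a \<Rightarrow> 'a) \<Rightarrow> ('a \<Rightarrow> 'a) \<Rightarrow> 'a \<Rightarrow> 'a \<Rightarrow> 'a \<Rightarrow> 'a"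
  where "bihom_associator \<mu> \<alpha> \<beta> x y z = \<mu> (\<mu> x y) (\<beta> z) - \<mu> (\<alpha> x) (\<mu> y z)"

locale left_bihom_alternative_algebra = vector_space scaleA
  for scaleA :: "'k::field_char_0 \<Rightarrow> 'a::ab_group_add \<Rightarrow> 'a" +
  fixes \<mu> :: "'a \<Rightarrow> 'a \<Rightarrow> 'a" (infixl \<open>\<cdot>\<close> 70)
    and \<alpha> \<beta> :: "'a \<Rightarrow> 'a"
  assumes bilinear_mult: "bilinear_map scaleA scaleA scaleA \<mu>"
    and linear_alpha: "Vector_Spaces.linear scaleA scaleA \<alpha>"
    and linear_beta: "Vector_Spaces.linear scaleA scaleA \<beta>"
    and alpha_beta_commute: "\<alpha> \<circ> \<beta> = \<beta> \<circ> \<alpha>"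
    and alpha_mult: "\<alpha> (x \<cdot> y) = \<alpha> x \<cdot> \<alpha> y"
    and beta_mult: "\<beta> (x \<cdot> y) = \<beta> x \<cdot> \<beta> y"
    and left_alternative:
      "bihom_associator \<mu> \<alpha> \<beta> (\<beta> x) (\<alpha> y) z + bihom_associator \<mu> \<alpha> \<beta> (\<beta> y) (\<alpha> x) z = 0"

text \<open>
  A linear map \<open>A \<rightarrow> gl(V)\<close> is represented in curried form; being linear with values in the linear
  endomorphisms of \<open>V\<close> is then the same as being bilinear.
\<close>

locale left_bihom_alternative_representation =
  left_bihom_alternative_algebra scaleA \<mu> \<alpha> \<beta> + V: vector_space scaleV
  for scaleA :: "'k::field_char_0 \<Rightarrow> 'a::ab_group_add \<Rightarrow> 'a"
    and \<mu> :: "'a \<Rightarrow> 'a \<Rightarrow> 'a" (infixl \<open>\<cdot>\<close> 70)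
    and \<alpha> \<beta> :: "'a \<Rightarrow> 'a"
    and scaleV :: "'k \<Rightarrow> 'v::ab_group_add \<Rightarrow> 'v" +
  fixes l r :: "'a \<Rightarrow> 'v \<Rightarrow> 'v"
    and \<phi> \<psi> :: "'v \<Rightarrow> 'v"
  assumes bilinear_l: "bilinear_map scaleA scaleV scaleV l"
    and bilinear_r: "bilinear_map scaleA scaleV scaleV r"
    and linear_phi: "Vector_Spaces.linear scaleV scaleV \<phi>"
    and linear_psi: "Vector_Spaces.linear scaleV scaleV \<psi>"
    and phi_psi_commute: "\<phi> \<circ> \<psi> = \<psi> \<circ> \<phi>"
    and phi_l: "\<phi> (l x v) = l (\<alpha> x) (\<phi> v)"
    and phi_r: "\<phi> (r x v) = r (\<alpha> x) (\<phi> v)"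
    and psi_l: "\<psi> (l x v) = l (\<beta> x) (\<psi> v)"
    and psi_r: "\<psi> (r x v) = r (\<beta> x) (\<psi> v)"
    and l_l: "l (\<beta> x \<cdot> \<alpha> x) (\<psi> v) = l (\<alpha> (\<beta> x)) (l (\<alpha> x) v)"
    and r_r: "r (\<beta> x \<cdot> \<alpha> x) (\<phi> v) = r (\<alpha> (\<beta> x)) (r (\<beta> x) v)"
    and r_l: "r (\<beta> y) (l (\<beta> x) (\<phi> v)) - l (\<alpha> (\<beta> x)) (r y (\<phi> v))
      = r (\<alpha> x \<cdot> y) (\<phi> (\<psi> v)) - r (\<beta> y) (r (\<alpha> x) (\<psi> v))"
    and l_r: "l (\<alpha> y) (r (\<alpha> x) (\<psi> v)) - r (\<alpha> (\<beta> x)) (l y (\<psi> v))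
      = l (y \<cdot> \<beta> x) (\<phi> (\<psi> v)) - l (\<alpha> y) (l (\<beta> x) (\<phi> v))"

text \<open>
  An \<open>n\<close>-linear map \<open>A\<^sup>n \<rightarrow> V\<close> is represented as a function on lists that vanishes on the lists
  of length other than \<open>n\<close>, so that equality of functions is equality of \<open>n\<close>-linear maps.
\<close>

definition multilinear_map ::
  "('k::field \<Rightarrow> 'a::ab_group_add \<Rightarrow> 'a) \<Rightarrow> ('k \<Rightarrow> 'v::ab_group_add \<Rightarrow> 'v) \<Rightarrow>
   nat \<Rightarrow> ('a list \<Rightarrow> 'v) \<Rightarrow> bool"
  where "multilinear_map sA sV n f \<longleftrightarrow>
    (\<forall>xs. length xs \<noteq> n \<longrightarrow> f xs = 0) \<and>
    (\<forall>xs i. length xs = n \<longrightarrow> i < n \<longrightarrow> Vector_Spaces.linear sA sV (\<lambda>x. f (xs[i := x])))"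

definition cochains ::
  "('k::field \<Rightarrow> 'a::ab_group_add \<Rightarrow> 'a) \<Rightarrow> ('k \<Rightarrow> 'v::ab_group_add \<Rightarrow> 'v) \<Rightarrow>
   ('a \<Rightarrow> 'a) \<Rightarrow> ('a \<Rightarrow> 'a) \<Rightarrow> ('v \<Rightarrow> 'v) \<Rightarrow> ('v \<Rightarrow> 'v) \<Rightarrow> nat \<Rightarrow> ('a list \<Rightarrow> 'v) set"
  where "cochains sA sV \<alpha> \<beta> \<phi> \<psi> n =
    {f. multilinear_map sA sV n f \<and>
        (\<forall>xs. length xs = n \<longrightarrow> \<phi> (f xs) = f (map \<alpha> xs) \<and> \<psi> (f xs) = f (map \<beta> xs))}"

definition delta1 ::
  "('a \<Rightarrow> 'a \<Rightarrow> 'a) \<Rightarrow> ('a \<Rightarrow> 'v \<Rightarrow> 'v) \<Rightarrow> ('a \<Rightarrow> 'v \<Rightarrow> 'v) \<Rightarrow>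
   ('a list \<Rightarrow> 'v::ab_group_add) \<Rightarrow> 'a list \<Rightarrow> 'v"
  where "delta1 \<mu> l r f xs =
    (case xs of [x, y] \<Rightarrow> l x (f [y]) + r y (f [x]) - f [\<mu> x y] | _ \<Rightarrow> 0)"

definition delta2 ::
  "('a \<Rightarrow> 'a \<Rightarrow> 'a) \<Rightarrow> ('a \<Rightarrow> 'a) \<Rightarrow> ('a \<Rightarrow> 'a) \<Rightarrow> ('a \<Rightarrow> 'v \<Rightarrow> 'v) \<Rightarrow> ('a \<Rightarrow> 'v \<Rightarrow> 'v) \<Rightarrow>
   ('a list \<Rightarrow> 'v::ab_group_add) \<Rightarrow> 'a list \<Rightarrow> 'v"
  where "delta2 \<mu> \<alpha> \<beta> l r f xs =
    (case xs of [x, y, z] \<Rightarrow>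
        r (\<beta> z) (f [\<beta> x, \<alpha> y]) - l (\<alpha> (\<beta> x)) (f [\<alpha> y, z])
      + r (\<beta> z) (f [\<beta> y, \<alpha> x]) - l (\<alpha> (\<beta> y)) (f [\<alpha> x, z])
      + f [\<mu> (\<beta> x) (\<alpha> y), \<beta> z] - f [\<alpha> (\<beta> x), \<mu> (\<alpha> y) z]
      + f [\<mu> (\<beta> y) (\<alpha> x), \<beta> z] - f [\<alpha> (\<beta> y), \<mu> (\<alpha> x) z]
    | _ \<Rightarrow> 0)"

context left_bihom_alternative_representation
begin

lemma linear_AV_iff:
  "Vector_Spaces.linear scaleA scaleV f \<longleftrightarrow>
    (\<forall>x y. f (x + y) = f x + f y) \<and> (\<forall>c x. f (scaleA c x) = scaleV c (f x))"
  by (simp add: Vector_Spaces.linear_iff vector_space_axioms V.vector_space_axioms)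

lemma structure_maps_add_scale:
  "(x + y) \<cdot> z = x \<cdot> z + y \<cdot> z" "z \<cdot> (x + y) = z \<cdot> x + z \<cdot> y"
  "scaleA c x \<cdot> z = scaleA c (x \<cdot> z)" "z \<cdot> scaleA c x = scaleA c (z \<cdot> x)"
  "\<alpha> (x + y) = \<alpha> x + \<alpha> y" "\<alpha> (scaleA c x) = scaleA c (\<alpha> x)"
  "\<beta> (x + y) = \<beta> x + \<beta> y" "\<beta> (scaleA c x) = scaleA c (\<beta> x)"
  "l (x + y) v = l x v + l y v" "l x (v + w) = l x v + l x w"
  "l (scaleA c x) v = scaleV c (l x v)" "l x (scaleV c v) = scaleV c (l x v)"
  "r (x + y) v = r x v + r y v" "r x (v + w) = r x v + r x w"
  "r (scaleA c x) v = scaleV c (r x v)" "r x (scaleV c v) = scaleV c (r x v)"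
  "\<phi> (v + w) = \<phi> v + \<phi> w" "\<phi> (scaleV c v) = scaleV c (\<phi> v)"
  "\<psi> (v + w) = \<psi> v + \<psi> w" "\<psi> (scaleV c v) = scaleV c (\<psi> v)"
  using bilinear_mult bilinear_l bilinear_r linear_alpha linear_beta linear_phi linear_psi
  by (simp_all add: bilinear_map_def Vector_Spaces.linear_iff)

lemma phi_psi_diff: "\<phi> (v - w) = \<phi> v - \<phi> w" "\<psi> (v - w) = \<psi> v - \<psi> w"
  using structure_maps_add_scale(17)[of "v - w" w] structure_maps_add_scale(19)[of "v - w" w]
  by (simp_all add: algebra_simps)

lemma cochain_1:
  assumes "f \<in> cochains scaleA scaleV \<alpha> \<beta> \<phi> \<psi> 1"
  shows "f [x + y] = f [x] + f [y]" "f [scaleA c x] = scaleV c (f [x])"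
    "\<phi> (f [x]) = f [\<alpha> x]" "\<psi> (f [x]) = f [\<beta> x]"
proof -
  have *: "Vector_Spaces.linear scaleA scaleV (\<lambda>x. f (xs[i := x]))" if "length xs = 1" "i < 1" for xs i
    using assms that unfolding cochains_def multilinear_map_def by blast
  show "f [x + y] = f [x] + f [y]" "f [scaleA c x] = scaleV c (f [x])"
    using *[of "[0]" 0] by (simp_all add: linear_AV_iff)
  show "\<phi> (f [x]) = f [\<alpha> x]" "\<psi> (f [x]) = f [\<beta> x]"
    using assms by (simp_all add: cochains_def)
qed

lemma cochain_2:
  assumes "f \<in> cochains scaleA scaleV \<alpha> \<beta> \<phi> \<psi> 2"
  shows "f [x + y, z] = f [x, z] + f [y, z]" "f [scaleA c x, z] = scaleV c (f [x, z])"
    "f [z, x + y] = f [z, x] + f [z, y]" "f [z, scaleA c x] = scaleV c (f [z, x])"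
    "\<phi> (f [x, y]) = f [\<alpha> x, \<alpha> y]" "\<psi> (f [x, y]) = f [\<beta> x, \<beta> y]"
proof -
  have *: "Vector_Spaces.linear scaleA scaleV (\<lambda>x. f (xs[i := x]))" if "length xs = 2" "i < 2" for xs i
    using assms that unfolding cochains_def multilinear_map_def by blast
  show "f [x + y, z] = f [x, z] + f [y, z]" "f [scaleA c x, z] = scaleV c (f [x, z])"
    using *[of "[0, z]" 0] by (simp_all add: linear_AV_iff)
  show "f [z, x + y] = f [z, x] + f [z, y]" "f [z, scaleA c x] = scaleV c (f [z, x])"
    using *[of "[z, 0]" 1] by (simp_all add: linear_AV_iff)
  show "\<phi> (f [x, y]) = f [\<alpha> x, \<alpha> y]" "\<psi> (f [x, y]) = f [\<beta> x, \<beta> y]"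
    using assms by (simp_all add: cochains_def)
qed

lemma alpha_beta_swap: "\<beta> (\<alpha> x) = \<alpha> (\<beta> x)"
  using alpha_beta_commute by (metis comp_apply)

lemma delta1_cochain:
  assumes f: "f \<in> cochains scaleA scaleV \<alpha> \<beta> \<phi> \<psi> 1"
  shows "delta1 \<mu> l r f \<in> cochains scaleA scaleV \<alpha> \<beta> \<phi> \<psi> 2"
  unfolding cochains_def multilinear_map_def
proof (intro CollectI conjI allI impI)
  fix xs :: "'a list" assume "length xs \<noteq> 2"
  then show "delta1 \<mu> l r f xs = 0" by (auto simp: delta1_def split: list.splits)
next
  fix xs :: "'a list" and i :: nat assume "length xs = 2" "i < 2"
  then obtain x y where "xs = [x, y]" "i = 0 \<or> i = 1"
    by (auto simp: numeral_2_eq_2 length_Suc_conv less_Suc_eq)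
  then show "Vector_Spaces.linear scaleA scaleV (\<lambda>x. delta1 \<mu> l r f (xs[i := x]))"
    by (elim disjE; simp add: linear_AV_iff delta1_def structure_maps_add_scale cochain_1[OF f]
        V.scale_right_distrib V.scale_right_diff_distrib; simp add: algebra_simps)
next
  fix xs :: "'a list" assume "length xs = 2"
  then obtain x y where "xs = [x, y]"
    by (auto simp: numeral_2_eq_2 length_Suc_conv)
  then show "\<phi> (delta1 \<mu> l r f xs) = delta1 \<mu> l r f (map \<alpha> xs)"
    and "\<psi> (delta1 \<mu> l r f xs) = delta1 \<mu> l r f (map \<beta> xs)"
    by (simp_all add: delta1_def structure_maps_add_scale phi_psi_diff phi_l phi_r psi_l psi_r
        cochain_1[OF f] alpha_mult beta_mult)
qed

lemma delta2_cochain: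
  assumes f: "f \<in> cochains scaleA scaleV \<alpha> \<beta> \<phi> \<psi> 2"
  shows "delta2 \<mu> \<alpha> \<beta> l r f \<in> cochains scaleA scaleV \<alpha> \<beta> \<phi> \<psi> 3"
  unfolding cochains_def multilinear_map_def
proof (intro CollectI conjI allI impI)
  fix xs :: "'a list" assume "length xs \<noteq> 3"
  then show "delta2 \<mu> \<alpha> \<beta> l r f xs = 0" by (auto simp: delta2_def split: list.splits)
next
  fix xs :: "'a list" and i :: nat assume "length xs = 3" "i < 3"
  then obtain x y z where "xs = [x, y, z]" "i = 0 \<or> i = 1 \<or> i = 2"
    by (auto simp: numeral_3_eq_3 length_Suc_conv less_Suc_eq)
  then show "Vector_Spaces.linear scaleA scaleV (\<lambda>x. delta2 \<mu> \<alpha> \<beta> l r f (xs[i := x]))"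
    by (elim disjE; simp add: linear_AV_iff delta2_def structure_maps_add_scale cochain_2[OF f]
        V.scale_right_distrib V.scale_right_diff_distrib; simp add: algebra_simps)
next
  fix xs :: "'a list" assume "length xs = 3"
  then obtain x y z where "xs = [x, y, z]"
    by (auto simp: numeral_3_eq_3 length_Suc_conv)
  then show "\<phi> (delta2 \<mu> \<alpha> \<beta> l r f xs) = delta2 \<mu> \<alpha> \<beta> l r f (map \<alpha> xs)"
    and "\<psi> (delta2 \<mu> \<alpha> \<beta> l r f xs) = delta2 \<mu> \<alpha> \<beta> l r f (map \<beta> xs)"
    by (simp_all add: delta2_def structure_maps_add_scale phi_psi_diff phi_l phi_r psi_l psi_r
        cochain_2[OF f] alpha_mult beta_mult alpha_beta_swap)
qed

end

end

theory Submission
  imports Defs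
begin

text \<open>
  Modulo the terms in \<open>f\<close> of an associator, which cancel by left alternativity, and after replacing
  \<open>f \<circ> \<alpha>\<close> and \<open>f \<circ> \<beta>\<close> by \<open>\<phi> \<circ> f\<close> and \<open>\<psi> \<circ> f\<close>, the terms of \<open>\<delta>\<^sup>2 (\<delta>\<^sup>1 f) (x, y, z)\<close> containing \<open>f z\<close>
  cancel by the polarisation of axiom (ii), and those containing \<open>f x\<close> or \<open>f y\<close> by axiom (iv).
\<close>

context left_bihom_alternative_representation
begin

text \<open>Axiom (ii) is quadratic in its algebra argument: subtracting its instances at
  \<open>x\<close> and \<open>y\<close> from the one at \<open>x + y\<close> leaves the cross
  terms.\<close>

lemma l_l_polarised:
  "l (\<beta> x \<cdot> \<alpha> y) (\<psi> v) + l (\<beta> y \<cdot> \<alpha> x) (\<psi> v)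
    = l (\<alpha> (\<beta> x)) (l (\<alpha> y) v) + l (\<alpha> (\<beta> y)) (l (\<alpha> x) v)"
  using l_l[of "x + y" v] l_l[of x v] l_l[of y v]
  by (simp add: structure_maps_add_scale algebra_simps)

lemma l_r_diff: "l x (v - w) = l x v - l x w" "r x (v - w) = r x v - r x w"
  using structure_maps_add_scale(10)[of x "v - w" w] structure_maps_add_scale(14)[of x "v - w" w]
  by (simp_all add: algebra_simps)

lemma delta2_delta1:
  assumes f: "f \<in> cochains scaleA scaleV \<alpha> \<beta> \<phi> \<psi> 1"
  shows "delta2 \<mu> \<alpha> \<beta> l r (delta1 \<mu> l r f) xs = 0"
proof (cases "\<exists>x y z. xs = [x, y, z]")
  case True
  then obtain x y z where xs: "xs = [x, y, z]" by blast
  have f_diff: "f [u - v] = f [u] - f [v]" for u v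
    using cochain_1(1)[OF f, of "u - v" v] by (simp add: algebra_simps)
  have f_zero: "f [0] = 0"
    using f_diff[of 0 0] by simp
  have assoc: "f [(\<beta> x \<cdot> \<alpha> y) \<cdot> \<beta> z] - f [\<alpha> (\<beta> x) \<cdot> (\<alpha> y \<cdot> z)]
      + (f [(\<beta> y \<cdot> \<alpha> x) \<cdot> \<beta> z] - f [\<alpha> (\<beta> y) \<cdot> (\<alpha> x \<cdot> z)]) = 0"
    (is "?as = 0")
    using arg_cong[OF left_alternative[of x y z], of "\<lambda>u. f [u]"]
    by (simp add: bihom_associator_def cochain_1(1)[OF f] f_diff f_zero)
  \<comment> \<open>The defect of \<open>r_l\<close> at \<open>f [v]\<close>. \<open>m x y\<close>
    collects every term in \<open>f\<close> of \<open>y\<close>: its first two come from one half of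
    \<open>delta2\<close>, the other two from the half with \<open>x\<close> and \<open>y\<close>
    exchanged.\<close>
  define m where "m u v = r (\<beta> z) (l (\<beta> u) (f [\<alpha> v])) - l (\<alpha> (\<beta> u)) (r z (f [\<alpha> v]))
      - (r (\<alpha> u \<cdot> z) (f [\<alpha> (\<beta> v)]) - r (\<beta> z) (r (\<alpha> u) (f [\<beta> v])))" for u v
  have mixed: "m u v = 0" for u v
    using r_l[of z u "f [v]"] by (simp add: m_def cochain_1(3,4)[OF f])
  have left: "l (\<beta> x \<cdot> \<alpha> y) (f [\<beta> z]) + l (\<beta> y \<cdot> \<alpha> x) (f [\<beta> z])
      - (l (\<alpha> (\<beta> x)) (l (\<alpha> y) (f [z])) + l (\<alpha> (\<beta> y)) (l (\<alpha> x) (f [z]))) = 0" (is "?l = 0")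
    using l_l_polarised[of x y "f [z]"] by (simp add: cochain_1(4)[OF f])
  \<comment> \<open>Terms such as \<open>r (\<beta> z) (f [\<beta> x \<cdot> \<alpha> y])\<close>
    and \<open>l (\<alpha> (\<beta> x)) (f [\<alpha> y \<cdot> z])\<close> occur twice with opposite
    signs and drop out.\<close>
  have "delta2 \<mu> \<alpha> \<beta> l r (delta1 \<mu> l r f) xs = ?l + m x y + m y x - ?as"
    by (simp add: xs delta2_def delta1_def m_def structure_maps_add_scale l_r_diff algebra_simps)
  then show ?thesis
    by (simp only: left mixed assoc) simp
qed (auto simp: delta2_def split: list.splits)

end

theorem proposition2p1:
  fixes scaleA :: "'k::field_char_0 \<Rightarrow> 'a::ab_group_add \<Rightarrow> 'a"
    and \<mu> :: "'a \<Rightarrow> 'a \<Rightarrow> 'a"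
    and \<alpha> \<beta> :: "'a \<Rightarrow> 'a"
    and scaleV :: "'k \<Rightarrow> 'v::ab_group_add \<Rightarrow> 'v"
    and l r :: "'a \<Rightarrow> 'v \<Rightarrow> 'v"
    and \<phi> \<psi> :: "'v \<Rightarrow> 'v"
  assumes "left_bihom_alternative_algebra scaleA \<mu> \<alpha> \<beta>"
    and "left_bihom_alternative_representation scaleA \<mu> \<alpha> \<beta> scaleV l r \<phi> \<psi>"
  shows "\<forall>f \<in> cochains scaleA scaleV \<alpha> \<beta> \<phi> \<psi> 1.
    (delta2 \<mu> \<alpha> \<beta> l r \<circ> delta1 \<mu> l r) f = (\<lambda>_. 0)"
  using left_bihom_alternative_representation.delta2_delta1[OF assms(2)]
  by (simp add: fun_eq_iff)

end
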